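(* Let $0\le\alpha<1$ and let $h(z)=z+\sum_{n=2}^{\infty}a_nz^n$ and $g(z)=\sum_{n=1}^{\infty}b_nz^n$ be power series whose coefficients satisfy (with $a_1=1$) $$|a_n|\le\tfrac16(2n+1)(n+1)\quad\text{and}\quad |b_n|\le\tfrac16(2n-1)(n-1)\qquad\text{for all } n\ge1.$$ Then $f=h+\overline{g}$ is univalent and fully starlike of order $\alpha$ in the disk $|z|<r_S$, where $r_S=r_S(\alpha)$ is the real root of the equation $$2(1-\alpha)(1-r)^4+\alpha(1-r)^2-(1+r)^2=0$$ in the interval $(0,1)$. Moreover, this result is sharp for each $\alpha\in[0,1)$: for each such $\alpha$, $r_S(\alpha)$ cannot be replaced by any larger number.
   Context: A complex-valued harmonic function $f$ with $f(0)=0$ is said to be fully starlike of order $\alpha$ ($0\le\alpha<1$) in a disk $|z|<\rho$ if, for every $0<r<\rho$, $f$ maps the circle $|z|=r$ in a one-to-one manner onto a curve that bounds a domain starlike with respect to the origin and satisfies $\frac{\partial}{\partial\theta}\arg f(re^{i\theta})>\alpha$ for $0\le\theta\le2\pi$. Fully starlike means fully starlike of order $0$. *)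

theory Defs
  imports "HOL-Analysis.Analysis"
begin

text \<open>\<open>fx\<close> and \<open>fy\<close> are the partial derivatives of \<open>f\<close> with respect to the real and the
  imaginary part of the argument, and \<open>f\<close> is totally (real) differentiable on \<open>S\<close>.\<close>
definition has_partials_on ::
    "(complex \<Rightarrow> complex) \<Rightarrow> (complex \<Rightarrow> complex) \<Rightarrow> (complex \<Rightarrow> complex) \<Rightarrow> complex set \<Rightarrow> bool" where
  "has_partials_on f fx fy S \<longleftrightarrow>
     (\<forall>z\<in>S. (f has_derivative (\<lambda>w. of_real (Re w) * fx z + of_real (Im w) * fy z)) (at z))"

text \<open>Complex-valued harmonic functions: twice continuously differentiable with vanishing
  Laplacian (equivalently, real and imaginary part are real harmonic).\<close>
definition harmonic_on :: "(complex \<Rightarrow> complex) \<Rightarrow> complex set \<Rightarrow> bool" where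
  "harmonic_on f S \<longleftrightarrow> open S \<and>
     (\<exists>fx fy fxx fxy fyx fyy.
        has_partials_on f fx fy S \<and> has_partials_on fx fxx fxy S \<and> has_partials_on fy fyx fyy S \<and>
        continuous_on S fxx \<and> continuous_on S fxy \<and> continuous_on S fyx \<and> continuous_on S fyy \<and>
        (\<forall>z\<in>S. fxx z + fyy z = 0))"

text \<open>The library's \<^const>\<open>starlike\<close> leaves the centre existentially quantified; here it is the origin.\<close>
definition starlike_origin :: "complex set \<Rightarrow> bool" where
  "starlike_origin D \<longleftrightarrow> 0 \<in> D \<and> (\<forall>w\<in>D. closed_segment 0 w \<subseteq> D)"

definition bounds_starlike_domain :: "complex set \<Rightarrow> bool" where
  "bounds_starlike_domain C \<longleftrightarrow>
     (\<exists>D. open D \<and> connected D \<and> bounded D \<and> frontier D = C \<and> starlike_origin D)"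

text \<open>The angular derivative of the argument of \<open>f\<close> along the circle of radius \<open>r\<close> exceeds \<open>\<alpha>\<close>:
  here \<open>\<phi>\<close> is a continuous branch of \<open>arg f(r e\<^sup>i\<^sup>\<theta>)\<close> on \<open>[0, 2\<pi>]\<close>. Any two such branches differ by a
  constant, so the existential quantifier involves no choice. The principal value \<^const>\<open>Arg\<close> would be
  unsuitable because of its jump.\<close>
definition arg_deriv_gt :: "real \<Rightarrow> (complex \<Rightarrow> complex) \<Rightarrow> real \<Rightarrow> bool" where
  "arg_deriv_gt \<alpha> f r \<longleftrightarrow>
     (\<exists>\<phi> \<phi>' :: real \<Rightarrow> real. \<forall>\<theta>\<in>{0..2*pi}.
        f (of_real r * cis \<theta>) \<noteq> 0 \<and>
        f (of_real r * cis \<theta>) = of_real (norm (f (of_real r * cis \<theta>))) * cis (\<phi> \<theta>) \<and>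
        (\<phi> has_real_derivative \<phi>' \<theta>) (at \<theta> within {0..2*pi}) \<and>
        \<phi>' \<theta> > \<alpha>)"

definition fully_starlike_of_order :: "real \<Rightarrow> (complex \<Rightarrow> complex) \<Rightarrow> real \<Rightarrow> bool" where
  "fully_starlike_of_order \<alpha> f \<rho> \<longleftrightarrow>
     harmonic_on f (ball 0 \<rho>) \<and> f 0 = 0 \<and>
     (\<forall>r. 0 < r \<and> r < \<rho> \<longrightarrow>
        inj_on f (sphere 0 r) \<and> bounds_starlike_domain (f ` sphere 0 r) \<and> arg_deriv_gt \<alpha> f r)"

definition coeff_bounds :: "(nat \<Rightarrow> complex) \<Rightarrow> (nat \<Rightarrow> complex) \<Rightarrow> bool" where
  "coeff_bounds a b \<longleftrightarrow> a 1 = 1 \<and>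
     (\<forall>n\<ge>1. norm (a n) \<le> 1/6 * (2 * real n + 1) * (real n + 1) \<and>
            norm (b n) \<le> 1/6 * (2 * real n - 1) * (real n - 1))"

text \<open>The values \<open>a 0\<close>, \<open>a 1\<close> and \<open>b 0\<close> do not enter the series. Under \<open>coeff_bounds\<close> both series converge
  in the open unit disk.\<close>
definition series_h :: "(nat \<Rightarrow> complex) \<Rightarrow> complex \<Rightarrow> complex" where
  "series_h a z = z + (\<Sum>n. a (n + 2) * z ^ (n + 2))"

definition series_g :: "(nat \<Rightarrow> complex) \<Rightarrow> complex \<Rightarrow> complex" where
  "series_g b z = (\<Sum>n. b (n + 1) * z ^ (n + 1))"

definition harmonic_map :: "(nat \<Rightarrow> complex) \<Rightarrow> (nat \<Rightarrow> complex) \<Rightarrow> complex \<Rightarrow> complex" where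
  "harmonic_map a b z = series_h a z + cnj (series_g b z)"

definition is_radius :: "real \<Rightarrow> real \<Rightarrow> bool" where
  "is_radius \<alpha> r \<longleftrightarrow> 0 < r \<and> r < 1 \<and>
     2 * (1 - \<alpha>) * (1 - r) ^ 4 + \<alpha> * (1 - r)\<^sup>2 - (1 + r)\<^sup>2 = 0"

definition r_S :: "real \<Rightarrow> real" where
  "r_S \<alpha> = (THE r. is_radius \<alpha> r)"

end

theory Submission
  imports Defs "HOL-Complex_Analysis.Cauchy_Integral_Formula"
begin

text \<open>
  Write \<open>f = h + cnj g\<close> and \<open>D z = z h'(z) - cnj (z g'(z))\<close>. Since \<open>f(r e\<^sup>i\<^sup>\<theta>)\<close> has \<open>\<theta>\<close>-derivative
  \<open>\<i> D\<close>, the argument of \<open>f\<close> grows at the rate \<open>Re (D / f)\<close>. With \<open>X = D - \<alpha> f\<close>, the condition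
  \<open>Re (D / f) > \<alpha>\<close> says \<open>Re (X cnj f) > 0\<close>, that is, \<open>\<bar>X - f\<bar> < \<bar>X + f\<bar>\<close>. Estimating both sides term
  by term shows that it holds at \<open>\<bar>z\<bar> = r\<close> as soon as
  \<open>(\<Sum>n\<ge>2. ((n - \<alpha>) A\<^sub>n + (n + \<alpha>) B\<^sub>n) r\<^sup>n) < (1 - \<alpha>) r\<close>,
  where \<open>A\<^sub>n\<close> and \<open>B\<^sub>n\<close> are the given coefficient bounds. As \<open>A\<^sub>n + B\<^sub>n = (2n\<^sup>2 + 1)/3\<close> and
  \<open>A\<^sub>n - B\<^sub>n = n\<close>, the sum has a closed form (\<open>maj_moments_eq\<close>), and the inequality becomes
  positivity of the polynomial that defines the radius; that polynomial is decreasing on \<open>[0, 1]\<close>.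

  Positivity for some order \<open>\<alpha>\<close> implies positivity for order \<open>0\<close>, which gives
  \<open>\<bar>h' - 1\<bar> + \<bar>g'\<bar> < 1\<close>. Hence \<open>Re h' > \<bar>g'\<bar>\<close>, so on every segment the component of \<open>f\<close> in the
  direction of the segment increases strictly, and \<open>f\<close> is injective (\<open>inj_on_add_cnj\<close>). It remains to
  see that each disk has a starlike image. The inverse of \<open>f\<close> is differentiable, and moving \<open>f z\<close>
  towards the origin decreases the modulus of the preimage, at a rate proportional to
  \<open>Re (f cnj D) > 0\<close> (\<open>inward_preimage_of_radial_step\<close>). The preimage of the whole segment from
  \<open>f z\<close> to \<open>0\<close> thus stays inside the disk of radius \<open>\<bar>z\<bar>\<close> (\<open>radial_segment_in_image_cball\<close>).

  For sharpness take \<open>a\<^sub>n = - A\<^sub>n\<close> for \<open>n \<ge> 2\<close> and \<open>b\<^sub>n = B\<^sub>n\<close>. At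
  the point \<open>r_S \<alpha>\<close> both estimates are then equalities and \<open>D = \<alpha> f\<close>, so the argument grows at the
  rate \<open>\<alpha>\<close> exactly on a circle that every larger disk contains.
\<close>

section \<open>Sums of an analytic and an anti-analytic function\<close>

lemma has_derivative_add_cnj:
  assumes "(h has_field_derivative h') (at z)" "(g has_field_derivative g') (at z)"
  shows "((\<lambda>z. h z + cnj (g z)) has_derivative (\<lambda>v. h' * v + cnj (g' * v))) (at z)"
  using assms unfolding has_field_derivative_def
  by (intro has_derivative_add bounded_linear.has_derivative[OF bounded_linear_cnj]) auto

text \<open>The class of functions \<open>h + cnj g\<close> is closed under partial differentiation: \<open>\<partial>\<^sub>x\<close> replaces
  \<open>(h, g)\<close> by \<open>(h', g')\<close> and \<open>\<partial>\<^sub>y\<close> replaces it by \<open>(\<i> h', \<i> g')\<close>. Applying this twice yields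
  harmonicity, as \<open>\<i>\<^sup>2 = -1\<close>.\<close>

lemma has_partials_on_add_cnj:
  assumes "\<And>z. z \<in> S \<Longrightarrow> (h has_field_derivative h' z) (at z)"
    and "\<And>z. z \<in> S \<Longrightarrow> (g has_field_derivative g' z) (at z)"
  shows "has_partials_on (\<lambda>z. h z + cnj (g z)) (\<lambda>z. h' z + cnj (g' z))
           (\<lambda>z. \<i> * h' z + cnj (\<i> * g' z)) S"
  unfolding has_partials_on_def
proof
  fix z assume z: "z \<in> S"
  have "(\<lambda>v. h' z * v + cnj (g' z * v)) =
      (\<lambda>w. of_real (Re w) * (h' z + cnj (g' z)) + of_real (Im w) * (\<i> * h' z + cnj (\<i> * g' z)))"
    by (rule ext) (simp add: complex_eq_iff algebra_simps)
  then show "((\<lambda>z. h z + cnj (g z)) has_derivative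
      (\<lambda>w. of_real (Re w) * (h' z + cnj (g' z)) + of_real (Im w) * (\<i> * h' z + cnj (\<i> * g' z)))) (at z)"
    using has_derivative_add_cnj[OF assms(1)[OF z] assms(2)[OF z]] by simp
qed

lemma harmonic_on_add_cnj:
  assumes "open S" and h: "h holomorphic_on S" and g: "g holomorphic_on S"
  shows "harmonic_on (\<lambda>z. h z + cnj (g z)) S"
proof -
  note D = holomorphic_derivI[OF _ \<open>open S\<close>]
  have h': "deriv h holomorphic_on S" and g': "deriv g holomorphic_on S"
    using assms by (auto intro: holomorphic_deriv)
  have h'': "deriv (deriv h) holomorphic_on S" and g'': "deriv (deriv g) holomorphic_on S"
    using assms h' g' by (auto intro: holomorphic_deriv)
  note C = holomorphic_on_imp_continuous_on
  let ?H = "deriv (deriv h)" and ?G = "deriv (deriv g)"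
  have 1: "has_partials_on (\<lambda>z. h z + cnj (g z)) (\<lambda>z. deriv h z + cnj (deriv g z))
           (\<lambda>z. \<i> * deriv h z + cnj (\<i> * deriv g z)) S"
    by (intro has_partials_on_add_cnj D[OF h] D[OF g])
  have 2: "has_partials_on (\<lambda>z. deriv h z + cnj (deriv g z)) (\<lambda>z. ?H z + cnj (?G z))
           (\<lambda>z. \<i> * ?H z + cnj (\<i> * ?G z)) S"
    by (intro has_partials_on_add_cnj D[OF h'] D[OF g'])
  have 3: "has_partials_on (\<lambda>z. \<i> * deriv h z + cnj (\<i> * deriv g z))
           (\<lambda>z. \<i> * ?H z + cnj (\<i> * ?G z))
           (\<lambda>z. \<i> * (\<i> * ?H z) + cnj (\<i> * (\<i> * ?G z))) S"
    by (intro has_partials_on_add_cnj DERIV_cmult D[OF h'] D[OF g'])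
  show ?thesis
    unfolding harmonic_on_def
    by (intro conjI exI, rule \<open>open S\<close>, rule 1, rule 2, rule 3)
       (auto intro!: continuous_intros C[OF h''] C[OF g''] simp: mult.assoc[symmetric])
qed

text \<open>The condition makes \<open>Re (cnj v \<partial>\<^sub>v f)\<close> positive for each direction \<open>v \<noteq> 0\<close>. So along the segment
  from \<open>z\<close> to \<open>w\<close>, with \<open>v = w - z\<close>, the quantity \<open>Re (cnj v f)\<close> would have to increase strictly between two
  points with the same value.\<close>

lemma inj_on_add_cnj:
  assumes "convex S"
    and h: "\<And>z. z \<in> S \<Longrightarrow> (h has_field_derivative h' z) (at z)"
    and g: "\<And>z. z \<in> S \<Longrightarrow> (g has_field_derivative g' z) (at z)"
    and pos: "\<And>z. z \<in> S \<Longrightarrow> norm (g' z) < Re (h' z)"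
  shows "inj_on (\<lambda>z. h z + cnj (g z)) S"
proof (rule inj_onI, rule ccontr)
  fix z w assume zw: "z \<in> S" "w \<in> S" "z \<noteq> w" and eq: "h z + cnj (g z) = h w + cnj (g w)"
  define v where "v = w - z"
  define \<gamma> where "\<gamma> t = z + of_real t * v" for t :: real
  define u where "u t = Re (cnj v * (h (\<gamma> t) + cnj (g (\<gamma> t))))" for t
  have \<gamma>: "\<gamma> t \<in> S" if "0 \<le> t" "t \<le> 1" for t
    using \<open>convex S\<close> zw that convexD_alt[of S z w t]
    by (simp add: \<gamma>_def v_def algebra_simps scaleR_conv_of_real)
  have du: "(u has_real_derivative
      Re (cnj v * (h' (\<gamma> t) * v + cnj (g' (\<gamma> t) * v)))) (at t)" if t: "0 \<le> t" "t \<le> 1" for t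
  proof -
    have "(\<gamma> has_vector_derivative v) (at t)"
      unfolding \<gamma>_def by (auto intro!: derivative_eq_intros simp: has_vector_derivative_def scaleR_conv_of_real)
    then have "((\<lambda>t. h (\<gamma> t) + cnj (g (\<gamma> t))) has_derivative
        (\<lambda>s. h' (\<gamma> t) * (s *\<^sub>R v) + cnj (g' (\<gamma> t) * (s *\<^sub>R v)))) (at t)"
      unfolding has_vector_derivative_def
      by (rule has_derivative_compose[OF _ has_derivative_add_cnj[OF h g]]) (use \<gamma> t in auto)
    then have "(u has_derivative (\<lambda>s. Re (cnj v * (h' (\<gamma> t) * (s *\<^sub>R v) + cnj (g' (\<gamma> t) * (s *\<^sub>R v)))))) (at t)"
      unfolding u_def
      by (intro bounded_linear.has_derivative[OF bounded_linear_Re] has_derivative_mult_right) auto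
    then show ?thesis
      unfolding has_field_derivative_def by (rule has_derivative_eq_rhs) (auto simp: algebra_simps)
  qed
  obtain t where t: "0 < t" "t < 1"
    and mvt: "u 1 - u 0 = (1 - 0) * Re (cnj v * (h' (\<gamma> t) * v + cnj (g' (\<gamma> t) * v)))"
    using MVT2[of 0 1 u "\<lambda>t. Re (cnj v * (h' (\<gamma> t) * v + cnj (g' (\<gamma> t) * v)))"] du by auto
  have "u 1 = u 0"
    using eq by (simp add: u_def \<gamma>_def v_def)
  have "Re (cnj v * (h' (\<gamma> t) * v + cnj (g' (\<gamma> t) * v)))
      = (norm v)\<^sup>2 * Re (h' (\<gamma> t)) + Re (cnj v * cnj (g' (\<gamma> t) * v))"
    unfolding cmod_power2 by (simp add: power2_eq_square algebra_simps)
  moreover have "\<bar>Re (cnj v * cnj (g' (\<gamma> t) * v))\<bar> \<le> (norm v)\<^sup>2 * norm (g' (\<gamma> t))"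
    by (rule order_trans[OF abs_Re_le_cmod]) (simp add: norm_mult power2_eq_square algebra_simps)
  moreover have "(norm v)\<^sup>2 * norm (g' (\<gamma> t)) < (norm v)\<^sup>2 * Re (h' (\<gamma> t))"
    using pos[OF \<gamma>[of t]] t zw by (simp add: v_def)
  ultimately show False
    using mvt \<open>u 1 = u 0\<close> by simp
qed

lemma has_vector_derivative_along_circle:
  assumes h: "(h has_field_derivative h') (at z)" and g: "(g has_field_derivative g') (at z)"
    and z: "z = of_real r * cis \<theta>"
  shows "((\<lambda>\<theta>. h (of_real r * cis \<theta>) + cnj (g (of_real r * cis \<theta>))) has_vector_derivative
           \<i> * (z * h' - cnj (z * g'))) (at \<theta> within T)"
proof -
  have "((\<lambda>\<theta>. of_real r * cis \<theta>) has_derivative (\<lambda>t. \<i> * z * of_real t)) (at \<theta> within T)"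
    unfolding z by (auto intro!: derivative_eq_intros simp: scaleR_conv_of_real)
  then have "((\<lambda>\<theta>. h (of_real r * cis \<theta>) + cnj (g (of_real r * cis \<theta>))) has_derivative
      (\<lambda>t. h' * (\<i> * z * of_real t) + cnj (g' * (\<i> * z * of_real t)))) (at \<theta> within T)"
    by (rule has_derivative_compose[where f = "\<lambda>\<theta>. of_real r * cis \<theta>" and g = "\<lambda>z. h z + cnj (g z)",
          OF _ has_derivative_add_cnj[OF h g, unfolded z]])
  then show ?thesis
    unfolding has_vector_derivative_def
    by (rule has_derivative_eq_rhs) (auto simp: scaleR_conv_of_real algebra_simps)
qed

section \<open>Starlike images of disks\<close>

text \<open>The differential \<open>v \<mapsto> p v + cnj (q v)\<close> has determinant \<open>J = \<bar>p\<bar>\<^sup>2 - \<bar>q\<bar>\<^sup>2\<close> and inverse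
  \<open>w \<mapsto> (cnj p w - cnj q cnj w) / J\<close>. Hence the squared modulus of the preimage of \<open>t f(z)\<close> has
  derivative \<open>2 Re (f(z) cnj (z p - cnj (z q))) / J > 0\<close> at \<open>t = 1\<close>.\<close>

lemma inward_preimage_of_radial_step:
  fixes f :: "complex \<Rightarrow> complex"
  assumes "open S" "z \<in> S" "continuous_on S f" "inj_on f S"
    and der: "(f has_derivative (\<lambda>v. p * v + cnj (q * v))) (at z)"
    and jac: "norm q < norm p"
    and pos: "0 < Re (f z * cnj (z * p - cnj (z * q)))"
  shows "\<exists>d>0. \<forall>s. 0 < s \<longrightarrow> s < d \<longrightarrow> (\<exists>\<zeta>\<in>S. norm \<zeta> < norm z \<and> f \<zeta> = of_real (1 - s) * f z)"
proof -
  \<comment> \<open>\<open>J\<close> is the Jacobian determinant and \<open>k\<close> the inverse of the differential at \<open>z\<close>.\<close>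
  define J where "J = (norm p)\<^sup>2 - (norm q)\<^sup>2"
  have J: "J > 0"
    using jac by (simp add: J_def power_strict_mono)
  have J': "complex_of_real J = p * cnj p - q * cnj q"
    unfolding J_def by (simp only: of_real_diff complex_norm_square)
  define k where "k w = (cnj p * w - cnj q * cnj w) / J" for w :: complex
  define F where "F = the_inv_into S f"
  have F: "F (f x) = x" if "x \<in> S" for x
    using that \<open>inj_on f S\<close> by (simp add: F_def the_inv_into_f_f)
  have "(\<lambda>v. p * v + cnj (q * v)) \<circ> k = id"
  proof (rule ext)
    fix w
    have "p * k w + cnj (q * k w) = (p * cnj p - q * cnj q) * w / J"
      using J by (simp add: k_def field_simps)
    also have "\<dots> = w"
      using J by (simp flip: J')
    finally show "((\<lambda>v. p * v + cnj (q * v)) \<circ> k) w = id w"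
      by simp
  qed
  then have dF: "(F has_derivative k) (at (f z))"
    using has_derivative_inverse_strong[OF \<open>open S\<close> \<open>z \<in> S\<close> \<open>continuous_on S f\<close> _ der] F by blast
  define \<psi> where "\<psi> t = (norm (F (of_real t * f z)))\<^sup>2" for t :: real
  have dline: "((\<lambda>t. of_real t * f z) has_derivative (\<lambda>s. of_real s * f z)) (at (1::real))"
    by (auto intro!: derivative_eq_intros)
  have dray: "((\<lambda>t. F (of_real t * f z)) has_derivative (\<lambda>s. k (of_real s * f z))) (at (1::real))"
    by (rule has_derivative_compose[OF dline]) (simp add: dF)
  have "(\<psi> has_derivative (\<lambda>s. 2 * (z \<bullet> k (of_real s * f z)))) (at 1)"
    unfolding \<psi>_def power2_norm_eq_inner
  proof (rule has_derivative_eq_rhs[OF has_derivative_inner[OF dray dray]], rule ext)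
    fix s :: real
    have "F (of_real 1 * f z) = z"
      using F[OF \<open>z \<in> S\<close>] by simp
    then show "F (of_real 1 * f z) \<bullet> k (of_real s * f z) + k (of_real s * f z) \<bullet> F (of_real 1 * f z)
        = 2 * (z \<bullet> k (of_real s * f z))"
      by (simp only: inner_commute[of "k (of_real s * f z)" z] mult_2)
  qed
  moreover have "(\<lambda>s. 2 * (z \<bullet> k (of_real s * f z))) = (\<lambda>s. (2 * (z \<bullet> k (f z))) * s)"
  proof (rule ext)
    fix s :: real
    have "k (of_real s * f z) = s *\<^sub>R k (f z)"
      by (simp add: k_def scaleR_conv_of_real algebra_simps diff_divide_distrib)
    then show "2 * (z \<bullet> k (of_real s * f z)) = (2 * (z \<bullet> k (f z))) * s"
      by simp
  qed
  ultimately have d\<psi>: "(\<psi> has_real_derivative 2 * (z \<bullet> k (f z))) (at 1)"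
    by (simp add: has_field_derivative_def)
  have "z \<bullet> k (f z) = Re (f z * cnj (z * p - cnj (z * q))) / J"
  proof -
    have "z \<bullet> k (f z) = Re (cnj z * k (f z))"
      by (simp add: inner_complex_def)
    also have "cnj z * k (f z) = (cnj (z * p) * f z - cnj (z * q * f z)) / of_real J"
      by (simp add: k_def algebra_simps)
    also have "Re \<dots> = Re (cnj (z * p) * f z - cnj (z * q * f z)) / J"
      by (rule Re_divide_of_real)
    also have "Re (cnj (z * p) * f z - cnj (z * q * f z)) = Re (f z * cnj (z * p - cnj (z * q)))"
      by (simp add: algebra_simps)
    finally show ?thesis .
  qed
  then have "z \<bullet> k (f z) > 0"
    using pos J by simp
  then obtain d1 where d1: "d1 > 0" "\<And>s. 0 < s \<Longrightarrow> s < d1 \<Longrightarrow> \<psi> (1 - s) < \<psi> 1"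
    using DERIV_pos_inc_left[OF d\<psi>] by auto
  have "open (f ` S)"
    using assms by (intro invariance_of_domain)
  then have "open ((\<lambda>t::real. of_real t * f z) -` (f ` S))"
    by (intro open_vimage continuous_intros)
  moreover have "1 \<in> (\<lambda>t::real. of_real t * f z) -` (f ` S)"
    using \<open>z \<in> S\<close> by simp
  ultimately obtain d2 where "d2 > 0" and ball: "ball 1 d2 \<subseteq> (\<lambda>t::real. of_real t * f z) -` (f ` S)"
    by (rule openE)
  then have d2: "d2 > 0" "\<And>t. dist 1 t < d2 \<Longrightarrow> of_real t * f z \<in> f ` S"
    by (auto simp del: ball_eq_greaterThanLessThan)
  show ?thesis
  proof (intro exI conjI allI impI)
    show "min d1 d2 > 0"
      using d1 d2 by simp
    fix s assume s: "0 < s" "s < min d1 d2"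
    then obtain \<zeta> where \<zeta>: "\<zeta> \<in> S" "f \<zeta> = of_real (1 - s) * f z"
      using d2(2)[of "1 - s"] by (auto simp: dist_real_def simp del: of_real_diff)
    have "\<psi> (1 - s) < \<psi> 1"
      using d1 s by simp
    then have "norm \<zeta> < norm z"
      using F[OF \<zeta>(1)] F[OF \<open>z \<in> S\<close>] \<zeta>(2) by (simp add: \<psi>_def power_less_imp_less_base)
    with \<zeta> show "\<exists>\<zeta>\<in>S. norm \<zeta> < norm z \<and> f \<zeta> = of_real (1 - s) * f z"
      by blast
  qed
qed

text \<open>If \<open>t f(z)\<close> were missed, consider the smallest \<open>m \<ge> t\<close> for which \<open>m f(z)\<close> is the image of a point
  \<open>w\<close> with \<open>\<bar>w\<bar> \<le> \<bar>z\<bar>\<close>; it exists by compactness. An inward step from \<open>w\<close> reaches still smaller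
  multiples of \<open>f(z)\<close>.\<close>

lemma radial_segment_in_image_cball:
  fixes f :: "complex \<Rightarrow> complex"
  assumes cont: "continuous_on (ball 0 \<rho>) f" and "f 0 = 0"
    and step: "\<And>z. z \<in> ball 0 \<rho> \<Longrightarrow> z \<noteq> 0 \<Longrightarrow>
      \<exists>d>0. \<forall>s. 0 < s \<longrightarrow> s < d \<longrightarrow> (\<exists>\<zeta>\<in>ball 0 \<rho>. norm \<zeta> < norm z \<and> f \<zeta> = of_real (1 - s) * f z)"
    and z: "z \<in> ball 0 \<rho>" and t: "0 \<le> t" "t \<le> 1"
  shows "of_real t * f z \<in> f ` cball 0 (norm z)"
proof (rule ccontr)
  assume t_out: "of_real t * f z \<notin> f ` cball 0 (norm z)"
  define K where "K = f ` cball 0 (norm z)"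
  define G where "G = {t..1} \<inter> (\<lambda>t. of_real t * f z) -` K"
  have sub: "cball 0 (norm z) \<subseteq> ball 0 \<rho>"
    using z by auto
  then have "compact K"
    unfolding K_def by (intro compact_continuous_image continuous_on_subset[OF cont]) auto
  then have "closed G"
    unfolding G_def by (intro continuous_closed_preimage continuous_intros compact_imp_closed closed_atLeastAtMost)
  moreover have "1 \<in> G"
    using t by (auto simp: G_def K_def)
  moreover have "bdd_below G"
    by (auto simp: G_def bdd_below_def)
  ultimately have m: "Inf G \<in> G"
    using closed_contains_Inf by blast
  define m where "m = Inf G"
  obtain w where w: "norm w \<le> norm z" "f w = of_real m * f z"
    using m by (auto simp: G_def K_def m_def)
  have "m \<noteq> t"
    using t_out m by (auto simp: G_def K_def m_def)
  then have "t < m"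
    using m by (auto simp: G_def m_def)
  have "z \<noteq> 0"
    using t_out \<open>f 0 = 0\<close> by auto
  have "f z \<noteq> 0"
  proof
    assume "f z = 0"
    moreover have "f 0 \<in> f ` cball 0 (norm z)"
      by (rule imageI) simp
    ultimately show False
      using t_out \<open>f 0 = 0\<close> by simp
  qed
  then have "w \<noteq> 0"
    using w \<open>f 0 = 0\<close> \<open>t < m\<close> t by auto
  then obtain d where d: "d > 0" and dw:
    "\<And>s. 0 < s \<Longrightarrow> s < d \<Longrightarrow> \<exists>\<zeta>\<in>ball 0 \<rho>. norm \<zeta> < norm w \<and> f \<zeta> = of_real (1 - s) * f w"
    using step[of w] w z by auto
  \<comment> \<open>The step is short enough not to jump below \<open>t\<close>: \<open>(1 - s) m \<ge> t\<close>.\<close>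
  define s where "s = min (d / 2) ((m - t) / m)"
  have "m > 0"
    using \<open>t < m\<close> t by simp
  have s: "0 < s" "s < d" "t \<le> (1 - s) * m"
  proof -
    have "s * m \<le> m - t"
      using \<open>m > 0\<close> by (simp add: s_def min_def field_simps)
    then show "t \<le> (1 - s) * m"
      by (simp add: algebra_simps)
  qed (use \<open>t < m\<close> \<open>m > 0\<close> d in \<open>auto simp: s_def\<close>)
  obtain \<zeta> where \<zeta>: "norm \<zeta> < norm w" "f \<zeta> = of_real (1 - s) * f w"
    using dw[OF s(1,2)] by blast
  have "(1 - s) * m < m"
    using s \<open>m > 0\<close> by (simp add: algebra_simps)
  moreover have "m \<le> 1"
    using m by (auto simp: G_def m_def)
  moreover have "of_real ((1 - s) * m) * f z = f \<zeta>"
    using \<zeta> w by simp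
  moreover have "f \<zeta> \<in> K"
    unfolding K_def using \<zeta>(1) w(1) by (intro imageI) simp
  ultimately have "(1 - s) * m \<in> G"
    using s by (simp add: G_def del: of_real_mult)
  then have "m \<le> (1 - s) * m"
    unfolding m_def using \<open>bdd_below G\<close> by (rule cInf_lower)
  then show False
    using \<open>(1 - s) * m < m\<close> by simp
qed

text \<open>The domain is the image of the open disk: it is open by invariance of domain, and injectivity
  on the larger disk separates it from the image of the circle.\<close>

lemma bounds_starlike_domain_image_sphere:
  fixes f :: "complex \<Rightarrow> complex"
  assumes cont: "continuous_on (ball 0 \<rho>) f" and inj: "inj_on f (ball 0 \<rho>)" and "f 0 = 0"
    and radial: "\<And>z t. z \<in> ball 0 \<rho> \<Longrightarrow> 0 \<le> t \<Longrightarrow> t \<le> 1 \<Longrightarrow> of_real t * f z \<in> f ` cball 0 (norm z)"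
    and r: "0 < r" "r < \<rho>"
  shows "bounds_starlike_domain (f ` sphere 0 r)"
  unfolding bounds_starlike_domain_def
proof (intro exI conjI)
  let ?D = "f ` ball 0 r"
  have sub: "cball 0 r \<subseteq> ball (0::complex) \<rho>" "ball 0 r \<subseteq> ball (0::complex) \<rho>"
    using r by auto
  note c = continuous_on_subset[OF cont sub(1)] continuous_on_subset[OF cont sub(2)]
  show op: "open ?D"
    using inj sub by (intro invariance_of_domain c) (auto intro: inj_on_subset)
  show "connected ?D"
    by (intro connected_continuous_image c) simp
  have comp: "compact (f ` cball 0 r)"
    by (intro compact_continuous_image c) simp
  show "bounded ?D"
    by (rule bounded_subset[OF compact_imp_bounded[OF comp]]) auto
  have "closure ?D \<subseteq> f ` cball 0 r"
    by (rule closure_minimal) (auto simp: compact_imp_closed comp)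
  moreover have "f ` cball 0 r \<subseteq> closure ?D"
    using image_closure_subset[of "ball 0 r" f "closure ?D"] c r by (simp add: closure_subset)
  ultimately have "closure ?D = f ` cball 0 r"
    by blast
  then have "frontier ?D = f ` cball 0 r - f ` ball 0 r"
    using op by (simp add: frontier_def interior_open)
  also have "\<dots> = f ` (cball 0 r - ball 0 r)"
    using inj sub by (intro inj_on_image_set_diff[symmetric, of f "ball 0 \<rho>"]) auto
  also have "cball 0 r - ball 0 r = sphere (0::complex) r"
    by auto
  finally show "frontier ?D = f ` sphere 0 r" .
  show "starlike_origin ?D"
    unfolding starlike_origin_def
  proof (intro conjI ballI subsetI)
    show "0 \<in> ?D"
      using r \<open>f 0 = 0\<close> by (auto intro!: image_eqI[of _ _ 0])
    fix w x assume "w \<in> ?D" "x \<in> closed_segment 0 w"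
    then obtain z t where z: "norm z < r" and t: "0 \<le> t" "t \<le> 1" "x = of_real t * f z"
      by (auto simp: in_segment scaleR_conv_of_real)
    then have "x \<in> f ` cball 0 (norm z)"
      using radial[of z t] r by auto
    then show "x \<in> ?D"
      using z by auto
  qed
qed

section \<open>The derivative of the argument along a circle\<close>

text \<open>A branch of the argument is the imaginary part of a primitive \<open>q\<close> of \<open>F' / F\<close>, shifted by a
  constant, because \<open>F exp (-q)\<close> has derivative \<open>0\<close>.\<close>

lemma arg_deriv_gt_if_log_deriv_gt:
  assumes F': "\<And>\<theta>. \<theta> \<in> {0..2*pi} \<Longrightarrow>
      ((\<lambda>\<theta>. f (of_real r * cis \<theta>)) has_vector_derivative F' \<theta>) (at \<theta> within {0..2*pi})"
    and cont: "continuous_on {0..2*pi} F'"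
    and nz: "\<And>\<theta>. \<theta> \<in> {0..2*pi} \<Longrightarrow> f (of_real r * cis \<theta>) \<noteq> 0"
    and gt: "\<And>\<theta>. \<theta> \<in> {0..2*pi} \<Longrightarrow> \<alpha> < Im (F' \<theta> / f (of_real r * cis \<theta>))"
  shows "arg_deriv_gt \<alpha> f r"
proof -
  define I where "I = {0..2*pi}"
  define F where "F \<theta> = f (of_real r * cis \<theta>)" for \<theta>
  define q where "q \<theta> = integral {0..\<theta>} (\<lambda>x. F' x / F x)" for \<theta>
  have dF: "(F has_vector_derivative F' \<theta>) (at \<theta> within I)" if "\<theta> \<in> I" for \<theta>
    using F' that by (simp add: F_def[abs_def] I_def)
  have F0: "F \<theta> \<noteq> 0" if "\<theta> \<in> I" for \<theta>
    using nz that by (simp add: F_def I_def)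
  have "continuous_on I F"
    by (rule continuous_on_vector_derivative[OF dF])
  then have "continuous_on I (\<lambda>x. F' x / F x)"
    using cont F0 by (intro continuous_intros) (auto simp: I_def)
  then have dq: "(q has_vector_derivative F' \<theta> / F \<theta>) (at \<theta> within I)" if "\<theta> \<in> I" for \<theta>
    using that unfolding q_def I_def by (rule integral_has_vector_derivative)
  have dexp: "((\<lambda>\<theta>. exp (- q \<theta>)) has_vector_derivative - (F' \<theta> / F \<theta>) * exp (- q \<theta>)) (at \<theta> within I)"
    if "\<theta> \<in> I" for \<theta>
    using field_vector_diff_chain_within[OF has_vector_derivative_minus[OF dq[OF that]]
        DERIV_subset[OF DERIV_exp]] by (simp add: o_def)
  have "((\<lambda>\<theta>. F \<theta> * exp (- q \<theta>)) has_vector_derivative 0) (at \<theta> within I)" if "\<theta> \<in> I" for \<theta>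
    using has_vector_derivative_mult[OF dF[OF that] dexp[OF that]] F0[OF that] by (simp add: field_simps)
  moreover have "convex I"
    by (simp add: I_def)
  ultimately obtain c where c: "\<And>\<theta>. \<theta> \<in> I \<Longrightarrow> F \<theta> * exp (- q \<theta>) = c"
    using has_vector_derivative_zero_constant[of I "\<lambda>\<theta>. F \<theta> * exp (- q \<theta>)"] by blast
  have Fc: "F \<theta> = c * exp (q \<theta>)" if "\<theta> \<in> I" for \<theta>
    using c[OF that] by (simp add: exp_minus field_simps)
  define \<phi> where "\<phi> \<theta> = Arg c + Im (q \<theta>)" for \<theta>
  show ?thesis
    unfolding arg_deriv_gt_def
  proof (rule exI[of _ \<phi>], rule exI[of _ "\<lambda>\<theta>. Im (F' \<theta> / F \<theta>)"], intro ballI conjI)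
    fix \<theta> :: real assume "\<theta> \<in> {0..2*pi}"
    then have \<theta>: "\<theta> \<in> I"
      by (simp add: I_def)
    show "f (of_real r * cis \<theta>) \<noteq> 0"
      using F0[OF \<theta>] by (simp add: F_def)
    have "F \<theta> = of_real (norm (F \<theta>)) * cis (\<phi> \<theta>)"
    proof -
      have "c = of_real (norm c) * cis (Arg c)"
        by (metis rcis_cmod_Arg rcis_def)
      moreover have "exp (q \<theta>) = of_real (norm (exp (q \<theta>))) * cis (Im (q \<theta>))"
        unfolding norm_exp_eq_Re by (rule exp_eq_polar)
      ultimately have "F \<theta> = (of_real (norm c) * of_real (norm (exp (q \<theta>)))) * (cis (Arg c) * cis (Im (q \<theta>)))"
        unfolding Fc[OF \<theta>] by (metis (no_types, lifting) mult.assoc mult.left_commute)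
      then show ?thesis
        using Fc[OF \<theta>] by (simp add: \<phi>_def norm_mult cis_mult)
    qed
    then show "f (of_real r * cis \<theta>) = of_real (norm (f (of_real r * cis \<theta>))) * cis (\<phi> \<theta>)"
      by (simp add: F_def)
    have "((\<lambda>x. Im (q x)) has_vector_derivative Im (F' \<theta> / F \<theta>)) (at \<theta> within I)"
      by (rule bounded_linear.has_vector_derivative[OF bounded_linear_Im dq[OF \<theta>]])
    then show "(\<phi> has_real_derivative Im (F' \<theta> / F \<theta>)) (at \<theta> within {0..2*pi})"
      unfolding \<phi>_def I_def by (auto intro!: derivative_eq_intros simp: has_real_derivative_iff_has_vector_derivative)
    show "\<alpha> < Im (F' \<theta> / F \<theta>)"
      using gt \<theta> by (simp add: F_def I_def)
  qed
qed

text \<open>Conversely, for any differentiable branch \<open>\<phi>\<close> the function \<open>F cis (-\<phi>)\<close> is real. Differentiating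
  the vanishing imaginary part gives \<open>\<phi>' = Im (F' / F)\<close>.\<close>

lemma log_deriv_gt_if_arg_deriv_gt:
  assumes "arg_deriv_gt \<alpha> f r" and \<theta>: "\<theta> \<in> {0..2*pi}"
    and F': "((\<lambda>\<theta>. f (of_real r * cis \<theta>)) has_vector_derivative F') (at \<theta> within {0..2*pi})"
  shows "f (of_real r * cis \<theta>) \<noteq> 0 \<and> \<alpha> < Im (F' / f (of_real r * cis \<theta>))"
proof -
  define I where "I = {0..2*pi}"
  define F where "F \<theta> = f (of_real r * cis \<theta>)" for \<theta>
  obtain \<phi> \<phi>' where
    nz: "\<And>\<theta>. \<theta> \<in> I \<Longrightarrow> F \<theta> \<noteq> 0" and
    polar: "\<And>\<theta>. \<theta> \<in> I \<Longrightarrow> F \<theta> = of_real (norm (F \<theta>)) * cis (\<phi> \<theta>)" and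
    d\<phi>: "\<And>\<theta>. \<theta> \<in> I \<Longrightarrow> (\<phi> has_real_derivative \<phi>' \<theta>) (at \<theta> within I)" and
    gt: "\<And>\<theta>. \<theta> \<in> I \<Longrightarrow> \<phi>' \<theta> > \<alpha>"
    using assms(1) unfolding arg_deriv_gt_def F_def[symmetric] I_def[symmetric] by blast
  have \<theta>I: "\<theta> \<in> I"
    using \<theta> by (simp add: I_def)
  have real: "F x * cis (- \<phi> x) = of_real (norm (F x))" if "x \<in> I" for x
    using polar[OF that] by (metis mult.assoc cis_mult add.right_inverse cis_zero mult.right_neutral)
  have dcis: "((\<lambda>x. cis (- \<phi> x)) has_vector_derivative - (\<i> * of_real (\<phi>' \<theta>) * cis (- \<phi> \<theta>))) (at \<theta> within I)"
  proof -
    have "((\<lambda>x. - \<phi> x) has_vector_derivative - \<phi>' \<theta>) (at \<theta> within I)"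
      using d\<phi>[OF \<theta>I] has_vector_derivative_minus has_real_derivative_iff_has_vector_derivative by blast
    moreover have "(cis has_vector_derivative \<i> * cis (- \<phi> \<theta>)) (at (- \<phi> \<theta>) within (\<lambda>x. - \<phi> x) ` I)"
      unfolding has_vector_derivative_def
      by (auto intro!: derivative_eq_intros simp: scaleR_conv_of_real)
    ultimately show ?thesis
      by (auto dest: vector_diff_chain_within simp: o_def scaleR_conv_of_real mult_ac)
  qed
  have "((\<lambda>x. Im (F x * cis (- \<phi> x))) has_vector_derivative
      Im (F \<theta> * - (\<i> * of_real (\<phi>' \<theta>) * cis (- \<phi> \<theta>)) + F' * cis (- \<phi> \<theta>))) (at \<theta> within I)"
    using F' by (intro bounded_linear.has_vector_derivative[OF bounded_linear_Im]
        has_vector_derivative_mult dcis) (simp add: F_def[abs_def] I_def)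
  moreover have "((\<lambda>x. Im (F x * cis (- \<phi> x))) has_vector_derivative 0) (at \<theta> within I)"
    by (rule has_vector_derivative_transform[OF \<theta>I _ has_vector_derivative_const[of 0]]) (simp add: real)
  ultimately have "Im (F \<theta> * - (\<i> * of_real (\<phi>' \<theta>) * cis (- \<phi> \<theta>)) + F' * cis (- \<phi> \<theta>)) = 0"
    unfolding I_def cbox_interval[symmetric]
    by (intro vector_derivative_unique_within_closed_interval[of 0 "2*pi" \<theta>]) (use \<theta> in auto)
  moreover have "F \<theta> * - (\<i> * of_real (\<phi>' \<theta>) * cis (- \<phi> \<theta>)) + F' * cis (- \<phi> \<theta>)
      = (F' / F \<theta> - \<i> * of_real (\<phi>' \<theta>)) * (F \<theta> * cis (- \<phi> \<theta>))"
    using nz[OF \<theta>I] by (simp add: field_simps)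
  ultimately have "Im ((F' / F \<theta> - \<i> * of_real (\<phi>' \<theta>)) * (F \<theta> * cis (- \<phi> \<theta>))) = 0"
    by metis
  then have "Im (F' / F \<theta>) = \<phi>' \<theta>"
    using nz[OF \<theta>I] by (simp add: real[OF \<theta>I])
  then show ?thesis
    using gt[OF \<theta>I] nz[OF \<theta>I] by (simp add: F_def)
qed

section \<open>A criterion for full starlikeness\<close>

text \<open>The whole definition of full starlikeness reduces to two pointwise inequalities. The one on
  \<open>Re h'\<close> yields injectivity and a nonzero Jacobian; the one on \<open>D\<close>, which is \<open>Re (D / f) > \<alpha>\<close> with
  the denominator cleared, yields the growth of the argument and, as \<open>\<alpha> \<ge> 0\<close>, the starlike shape.\<close>

lemma fully_starlike_of_order_add_cnj:
  fixes h g :: "complex \<Rightarrow> complex"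
  defines "f \<equiv> \<lambda>z. h z + cnj (g z)"
  assumes h: "h holomorphic_on ball 0 \<rho>" and g: "g holomorphic_on ball 0 \<rho>"
    and "f 0 = 0" and "0 \<le> \<alpha>"
    and dom: "\<And>z. z \<in> ball 0 \<rho> \<Longrightarrow> norm (deriv g z) < Re (deriv h z)"
    and star: "\<And>z. z \<in> ball 0 \<rho> \<Longrightarrow> z \<noteq> 0 \<Longrightarrow>
      0 < Re ((z * deriv h z - cnj (z * deriv g z) - of_real \<alpha> * f z) * cnj (f z))"
  shows "inj_on f (ball 0 \<rho>)" and "fully_starlike_of_order \<alpha> f \<rho>"
proof -
  note dh = holomorphic_derivI[OF h open_ball] and dg = holomorphic_derivI[OF g open_ball]
  define D where "D z = z * deriv h z - cnj (z * deriv g z)" for z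
  have star': "\<alpha> * (norm (f z))\<^sup>2 < Re (D z * cnj (f z))" if "z \<in> ball 0 \<rho>" "z \<noteq> 0" for z
  proof -
    have "Re ((D z - of_real \<alpha> * f z) * cnj (f z)) = Re (D z * cnj (f z)) - \<alpha> * Re (f z * cnj (f z))"
      by (simp add: algebra_simps)
    also have "Re (f z * cnj (f z)) = (norm (f z))\<^sup>2"
      by (simp flip: complex_norm_square)
    finally show ?thesis
      using star[OF that] by (simp add: D_def)
  qed
  have nz: "f z \<noteq> 0" if "z \<in> ball 0 \<rho>" "z \<noteq> 0" for z
    using star'[OF that] by auto
  have df: "(f has_derivative (\<lambda>v. deriv h z * v + cnj (deriv g z * v))) (at z)" if "z \<in> ball 0 \<rho>" for z
    unfolding f_def by (intro has_derivative_add_cnj dh dg that)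
  have cont: "continuous_on (ball 0 \<rho>) f"
    unfolding f_def by (intro continuous_intros holomorphic_on_imp_continuous_on h g)
  have contD: "continuous_on (ball 0 \<rho>) D"
    unfolding D_def
    by (intro continuous_intros holomorphic_on_imp_continuous_on holomorphic_deriv h g open_ball)
  show inj: "inj_on f (ball 0 \<rho>)"
    unfolding f_def by (rule inj_on_add_cnj[OF convex_ball dh dg dom])
  have radial: "of_real t * f z \<in> f ` cball 0 (norm z)" if "z \<in> ball 0 \<rho>" "0 \<le> t" "t \<le> 1" for z t
  proof (rule radial_segment_in_image_cball[OF cont \<open>f 0 = 0\<close> _ that])
    fix z :: complex assume z: "z \<in> ball 0 \<rho>" "z \<noteq> 0"
    have "norm (deriv g z) < norm (deriv h z)"
      using dom[OF z(1)] complex_Re_le_cmod[of "deriv h z"] by linarith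
    moreover have "0 < Re (f z * cnj (D z))"
    proof -
      have "0 \<le> \<alpha> * (norm (f z))\<^sup>2"
        using \<open>0 \<le> \<alpha>\<close> by simp
      also have "\<dots> < Re (D z * cnj (f z))"
        by (rule star'[OF z])
      finally show ?thesis
        by (simp add: algebra_simps)
    qed
    ultimately show "\<exists>d>0. \<forall>s. 0 < s \<longrightarrow> s < d \<longrightarrow>
        (\<exists>\<zeta>\<in>ball 0 \<rho>. norm \<zeta> < norm z \<and> f \<zeta> = of_real (1 - s) * f z)"
      unfolding D_def by (intro inward_preimage_of_radial_step[OF open_ball z(1) cont inj df[OF z(1)]])
  qed
  have arg: "arg_deriv_gt \<alpha> f r" if r: "0 < r" "r < \<rho>" for r
  proof (rule arg_deriv_gt_if_log_deriv_gt)
    have circ: "of_real r * cis \<theta> \<in> ball 0 \<rho>" "of_real r * cis \<theta> \<noteq> 0" for \<theta>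
      using r by (auto simp: norm_mult)
    let ?F' = "\<lambda>\<theta>. \<i> * D (of_real r * cis \<theta>)"
    show "((\<lambda>\<theta>. f (of_real r * cis \<theta>)) has_vector_derivative ?F' \<theta>) (at \<theta> within {0..2*pi})" for \<theta>
      unfolding f_def D_def by (rule has_vector_derivative_along_circle[OF dh dg refl]) (rule circ)+
    show "continuous_on {0..2*pi} ?F'"
      using circ by (intro continuous_intros continuous_on_compose2[OF contD]) auto
    fix \<theta>
    let ?z = "of_real r * cis \<theta>"
    show "f ?z \<noteq> 0"
      by (rule nz[OF circ])
    then have "\<alpha> < Re (D ?z * cnj (f ?z)) / (norm (f ?z))\<^sup>2"
      using star'[OF circ] by (simp add: pos_less_divide_eq)
    also have "\<dots> = Re (D ?z / f ?z)"
      unfolding complex_div_cnj[of "D ?z"] by (simp flip: of_real_power)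
    also have "\<dots> = Im (?F' \<theta> / f ?z)"
      unfolding times_divide_eq_right[symmetric] Im_i_times ..
    finally show "\<alpha> < Im (?F' \<theta> / f ?z)" .
  qed
  show "fully_starlike_of_order \<alpha> f \<rho>"
    unfolding fully_starlike_of_order_def
  proof (intro conjI allI impI)
    show "harmonic_on f (ball 0 \<rho>)"
      unfolding f_def by (rule harmonic_on_add_cnj[OF open_ball h g])
    fix r assume r: "0 < r \<and> r < \<rho>"
    show "inj_on f (sphere 0 r)"
      by (rule inj_on_subset[OF inj]) (use r in auto)
    show "bounds_starlike_domain (f ` sphere 0 r)"
      using r by (intro bounds_starlike_domain_image_sphere[OF cont inj \<open>f 0 = 0\<close> radial]) auto
    show "arg_deriv_gt \<alpha> f r"
      using arg r by simp
  qed (rule \<open>f 0 = 0\<close>)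
qed

lemma fully_starlike_of_order_cong:
  assumes eq: "\<And>z. z \<in> ball 0 \<rho> \<Longrightarrow> f z = g z" and "0 < \<rho>"
    and f: "fully_starlike_of_order \<alpha> f \<rho>"
  shows "fully_starlike_of_order \<alpha> g \<rho>"
proof -
  have "harmonic_on g (ball 0 \<rho>)"
  proof -
    have "has_partials_on g fx fy (ball 0 \<rho>)" if "has_partials_on f fx fy (ball 0 \<rho>)" for fx fy
      using that eq unfolding has_partials_on_def
      by (auto intro: has_derivative_transform_within_open[OF _ open_ball])
    then show ?thesis
      using f unfolding fully_starlike_of_order_def harmonic_on_def by blast
  qed
  moreover have "inj_on g (sphere 0 r) \<and> bounds_starlike_domain (g ` sphere 0 r) \<and> arg_deriv_gt \<alpha> g r"
    if r: "0 < r" "r < \<rho>" for r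
  proof -
    have sph: "f z = g z" if "z \<in> sphere 0 r" for z
      using that r eq by simp
    then have "f ` sphere 0 r = g ` sphere 0 r"
      by (rule image_cong[OF refl])
    moreover have "inj_on f (sphere 0 r) \<longleftrightarrow> inj_on g (sphere 0 r)"
      using sph by (rule inj_on_cong)
    moreover have "f (of_real r * cis \<theta>) = g (of_real r * cis \<theta>)" for \<theta>
      using r by (intro sph) (simp add: norm_mult)
    then have "arg_deriv_gt \<alpha> f r \<longleftrightarrow> arg_deriv_gt \<alpha> g r"
      by (simp add: arg_deriv_gt_def)
    ultimately show ?thesis
      using f r by (auto simp: fully_starlike_of_order_def)
  qed
  ultimately show ?thesis
    using f eq[of 0] \<open>0 < \<rho>\<close> by (simp add: fully_starlike_of_order_def)
qed

section \<open>Power series with quadratically bounded coefficients\<close>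

text \<open>The Euler operator \<open>x d/dx\<close> multiplies the \<open>n\<close>-th coefficient by \<open>n\<close>. Iterating it on the
  geometric series evaluates the sums below.\<close>

lemma sums_mult_index:
  fixes c :: "nat \<Rightarrow> real"
  assumes "\<And>x. \<bar>x\<bar> < 1 \<Longrightarrow> (\<lambda>n. c n * x ^ n) sums F x"
    and "(F has_real_derivative F') (at x)" and "\<bar>x\<bar> < 1"
  shows "(\<lambda>n. (real n * c n) * x ^ n) sums (x * F')"
proof -
  have "(\<lambda>n. diffs c n * x ^ n) sums F'"
    using assms by (intro termdiffs_sums_strong[of 1 c F]) auto
  then have "(\<lambda>n. x * (diffs c n * x ^ n)) sums (x * F')"
    by (rule sums_mult)
  also have "(\<lambda>n. x * (diffs c n * x ^ n)) = (\<lambda>n. (real (Suc n) * c (Suc n)) * x ^ Suc n)"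
    by (simp add: diffs_def algebra_simps)
  finally show ?thesis
    by (subst (asm) sums_Suc_iff) simp
qed

lemma power_moment_sums:
  fixes x :: real
  assumes "\<bar>x\<bar> < 1"
  shows "(\<lambda>n. real n * x ^ n) sums (x / (1 - x)\<^sup>2)"
    and "(\<lambda>n. real n ^ 3 * x ^ n) sums (x * (1 + 4 * x + x\<^sup>2) / (1 - x) ^ 4)"
proof -
  have s0: "(\<lambda>n. 1 * x ^ n) sums (1 / (1 - x))" if "\<bar>x\<bar> < 1" for x :: real
    using geometric_sums[of x] that by simp
  have s1: "(\<lambda>n. real n * x ^ n) sums (x / (1 - x)\<^sup>2)" if "\<bar>x\<bar> < 1" for x :: real
  proof -
    have "((\<lambda>x. 1 / (1 - x)) has_real_derivative 1 / (1 - x)\<^sup>2) (at x)"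
      using that by (auto intro!: derivative_eq_intros simp: power2_eq_square)
    from sums_mult_index[OF s0 this that] show ?thesis
      by simp
  qed
  have s2: "(\<lambda>n. (real n * real n) * x ^ n) sums (x * ((1 + x) / (1 - x) ^ 3))" if "\<bar>x\<bar> < 1" for x :: real
  proof -
    define y where "y = 1 - x"
    have y: "y \<noteq> 0" "x = 1 - y"
      using that by (auto simp: y_def)
    have "((\<lambda>x. x / (1 - x)\<^sup>2) has_real_derivative
        (y\<^sup>2 - x * (- (2 * y))) / (y\<^sup>2 * y\<^sup>2)) (at x)"
      using y(1) unfolding y_def by (auto intro!: derivative_eq_intros simp: algebra_simps)
    moreover have "(y\<^sup>2 - x * (- (2 * y))) / (y\<^sup>2 * y\<^sup>2) = (1 + x) / y ^ 3"
      using y(1) by (simp add: y(2) divide_simps) (simp add: eval_nat_numeral algebra_simps)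
    ultimately have "((\<lambda>x. x / (1 - x)\<^sup>2) has_real_derivative (1 + x) / (1 - x) ^ 3) (at x)"
      by (simp add: y_def)
    from sums_mult_index[OF s1 this that] show ?thesis
      by simp
  qed
  have s3: "(\<lambda>n. real n ^ 3 * x ^ n) sums (x * ((1 + 4 * x + x\<^sup>2) / (1 - x) ^ 4))" if "\<bar>x\<bar> < 1" for x :: real
  proof -
    define y where "y = 1 - x"
    have y: "y \<noteq> 0" "x = 1 - y"
      using that by (auto simp: y_def)
    have "((\<lambda>x. x * ((1 + x) / (1 - x) ^ 3)) has_real_derivative
        ((1 + 2 * x) * y ^ 3 + x * (1 + x) * (3 * y\<^sup>2)) / y ^ 6) (at x)"
      using y(1) unfolding y_def by (auto intro!: derivative_eq_intros)
    moreover have "((1 + 2 * x) * y ^ 3 + x * (1 + x) * (3 * y\<^sup>2)) / y ^ 6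
        = (1 + 4 * x + x\<^sup>2) / y ^ 4"
      using y(1) by (simp add: y(2) divide_simps) (simp add: eval_nat_numeral algebra_simps)
    ultimately have "((\<lambda>x. x * ((1 + x) / (1 - x) ^ 3)) has_real_derivative
        (1 + 4 * x + x\<^sup>2) / (1 - x) ^ 4) (at x)"
      by (simp add: y_def)
    from sums_mult_index[OF s2 this that] show ?thesis
      by (simp add: power3_eq_cube mult.assoc)
  qed
  show "(\<lambda>n. real n * x ^ n) sums (x / (1 - x)\<^sup>2)"
    and "(\<lambda>n. real n ^ 3 * x ^ n) sums (x * (1 + 4 * x + x\<^sup>2) / (1 - x) ^ 4)"
    using s1[OF assms] s3[OF assms] by simp_all
qed

text \<open>The coefficient bounds of the theorem are quadratic in \<open>n\<close>; this growth is all that the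
  convergence arguments use.\<close>

lemma summable_quadratic_coeffs:
  fixes c :: "nat \<Rightarrow> 'a::{real_normed_field,banach}"
  assumes c: "\<And>n. norm (c n) \<le> (real n)\<^sup>2" and z: "norm z < 1"
  shows "summable (\<lambda>n. c n * z ^ n)" and "summable (\<lambda>n. of_nat n * c n * z ^ n)"
proof -
  have cubic: "summable (\<lambda>n. real n ^ 3 * norm z ^ n)"
    using power_moment_sums(2)[of "norm z"] z by (auto dest: sums_summable)
  have "norm (c n * z ^ n) \<le> real n ^ 3 * norm z ^ n"
    and "norm (of_nat n * c n * z ^ n) \<le> real n ^ 3 * norm z ^ n" for n
  proof -
    have "real n * norm (c n) \<le> real n ^ 3"
      using mult_left_mono[OF c[of n], of "real n"] by (simp add: power3_eq_cube power2_eq_square)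
    moreover have "norm (c n) \<le> real n * norm (c n)"
      using c[of n] by (cases n) (auto simp: algebra_simps)
    ultimately show "norm (c n * z ^ n) \<le> real n ^ 3 * norm z ^ n"
      and "norm (of_nat n * c n * z ^ n) \<le> real n ^ 3 * norm z ^ n"
      by (auto simp: norm_mult norm_power intro!: mult_right_mono)
  qed
  then show "summable (\<lambda>n. c n * z ^ n)" and "summable (\<lambda>n. of_nat n * c n * z ^ n)"
    by (auto intro!: summable_comparison_test'[OF cubic, of 0])
qed

definition power_series :: "(nat \<Rightarrow> complex) \<Rightarrow> complex \<Rightarrow> complex" where
  "power_series c z = (\<Sum>n. c n * z ^ n)"

lemma power_series_sums:
  assumes c: "\<And>n. norm (c n) \<le> (real n)\<^sup>2" and z: "norm z < 1"
  shows "(\<lambda>n. c n * z ^ n) sums power_series c z"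
    and "(power_series c has_field_derivative deriv (power_series c) z) (at z)"
    and "(\<lambda>n. diffs c n * z ^ n) sums deriv (power_series c) z"
    and "(\<lambda>n. of_nat n * c n * z ^ n) sums (z * deriv (power_series c) z)"
proof -
  note sm = summable_quadratic_coeffs(1)[of c, OF c]
  show "(\<lambda>n. c n * z ^ n) sums power_series c z"
    using sm[OF z] by (simp add: power_series_def summable_sums)
  have d: "(power_series c has_field_derivative (\<Sum>n. diffs c n * z ^ n)) (at z)"
    unfolding power_series_def by (rule termdiffs_strong'[OF sm z])
  then have eq: "deriv (power_series c) z = (\<Sum>n. diffs c n * z ^ n)"
    by (rule DERIV_imp_deriv)
  with d show "(power_series c has_field_derivative deriv (power_series c) z) (at z)"
    by simp
  show "(\<lambda>n. diffs c n * z ^ n) sums deriv (power_series c) z"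
    unfolding eq using termdiff_converges[OF z sm] by (simp add: summable_sums)
  then have "(\<lambda>n. z * (diffs c n * z ^ n)) sums (z * deriv (power_series c) z)"
    by (rule sums_mult)
  also have "(\<lambda>n. z * (diffs c n * z ^ n)) = (\<lambda>n. of_nat (Suc n) * c (Suc n) * z ^ Suc n)"
    by (simp add: diffs_def algebra_simps)
  finally show "(\<lambda>n. of_nat n * c n * z ^ n) sums (z * deriv (power_series c) z)"
    by (subst (asm) sums_Suc_iff) simp
qed

lemma deriv_power_series_0:
  assumes "\<And>n. norm (c n) \<le> (real n)\<^sup>2"
  shows "deriv (power_series c) 0 = c 1"
  using sums_unique2[OF power_series_sums(3)[OF assms] powser_sums_zero] by (simp add: diffs_def)

text \<open>The operators \<open>z d/dz + s\<close> act on coefficients as multiplication by \<open>n + s\<close>. For series that start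
  at \<open>n = 2\<close> these factors are nonnegative when \<open>s \<ge> -2\<close>, so the triangle inequality may be applied
  with the majorant coefficients. Both signs of \<open>s\<close> are needed to bound \<open>X - f\<close> and \<open>X + f\<close>.\<close>

lemma norm_power_series_combination_le:
  assumes c: "\<And>n. norm (c n) \<le> C n" and C: "\<And>n. C n \<le> (real n)\<^sup>2" "C 0 = 0" "C 1 = 0"
    and s: "- 2 \<le> s" and z: "norm z < 1"
  shows "norm (z * deriv (power_series c) z + of_real s * power_series c z)
    \<le> (\<Sum>n. real n * C n * norm z ^ n) + s * (\<Sum>n. C n * norm z ^ n)"
proof -
  have c2: "norm (c n) \<le> (real n)\<^sup>2" for n
    using c C order_trans by blast
  have C0: "0 \<le> C n" for n
    using c[of n] norm_ge_zero[of "c n"] by linarith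
  have summ: "summable (\<lambda>n. C n * norm z ^ n)" "summable (\<lambda>n. real n * C n * norm z ^ n)"
    using summable_quadratic_coeffs[of C "norm z"] C0 C z by auto
  have "(\<lambda>n. of_nat n * c n * z ^ n + of_real s * (c n * z ^ n)) sums
      (z * deriv (power_series c) z + of_real s * power_series c z)"
    by (intro sums_add sums_mult power_series_sums c2 z)
  moreover have "(\<lambda>n. real n * C n * norm z ^ n + s * (C n * norm z ^ n)) sums
      ((\<Sum>n. real n * C n * norm z ^ n) + s * (\<Sum>n. C n * norm z ^ n))"
    by (intro sums_add sums_mult summable_sums summ)
  moreover have "norm (of_nat n * c n * z ^ n + of_real s * (c n * z ^ n))
      \<le> real n * C n * norm z ^ n + s * (C n * norm z ^ n)" for n
  proof -
    have "c n = 0" if "n < 2"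
    proof -
      have "n = 0 \<or> n = 1"
        using that by linarith
      then show ?thesis
        using c[of n] C by auto
    qed
    then have *: "n < 2 \<Longrightarrow> c n = 0" "n < 2 \<Longrightarrow> C n = 0"
      using C by (auto simp: less_2_cases_iff)
    show ?thesis
    proof (cases "n < 2")
      case False
      have "of_nat n * c n * z ^ n + of_real s * (c n * z ^ n) = of_real (real n + s) * c n * z ^ n"
        by (simp add: algebra_simps)
      also have "norm \<dots> = (real n + s) * norm (c n) * norm z ^ n"
        using False s by (simp add: norm_mult norm_power del: of_real_add)
      also have "\<dots> \<le> (real n + s) * C n * norm z ^ n"
        using False s c[of n] by (intro mult_right_mono mult_left_mono) auto
      finally show ?thesis
        by (simp add: algebra_simps)
    qed (simp add: *)
  qed
  ultimately show ?thesis
    by (metis (no_types, lifting) norm_sums_le)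
qed

section \<open>The majorants and the radius polynomial\<close>

text \<open>The identity is the dominant term of \<open>f\<close>; the estimates treat the terms with \<open>n \<ge> 2\<close> as a
  perturbation of it.\<close>

definition tail :: "(nat \<Rightarrow> 'a::zero) \<Rightarrow> nat \<Rightarrow> 'a" where
  "tail c n = (if n < 2 then 0 else c n)"

lemma tail_0_1: "tail c 0 = 0" "tail c (Suc 0) = 0"
  by (simp_all add: tail_def)

definition maj_a :: "nat \<Rightarrow> real" where
  "maj_a = tail (\<lambda>n. 1/6 * (2 * real n + 1) * (real n + 1))"

definition maj_b :: "nat \<Rightarrow> real" where
  "maj_b = tail (\<lambda>n. 1/6 * (2 * real n - 1) * (real n - 1))"

lemma maj_bounds:
  "0 \<le> maj_a n" "maj_a n \<le> (real n)\<^sup>2" "0 \<le> maj_b n" "maj_b n \<le> (real n)\<^sup>2"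
  "maj_a 0 = 0" "maj_a 1 = 0" "maj_b 0 = 0" "maj_b 1 = 0"
proof -
  have "1/6 * (2 * real n + 1) * (real n + 1) \<le> (real n)\<^sup>2"
    "1/6 * (2 * real n - 1) * (real n - 1) \<le> (real n)\<^sup>2" if "2 \<le> n"
  proof -
    have "2 * real n \<le> real n * real n"
      using that by (intro mult_right_mono) auto
    moreover have "2 \<le> real n"
      using that by simp
    moreover have "1/6 * (2 * real n + 1) * (real n + 1) = real n * real n / 3 + real n / 2 + 1/6"
      "1/6 * (2 * real n - 1) * (real n - 1) = real n * real n / 3 - real n / 2 + 1/6"
      by (simp_all add: field_simps)
    ultimately show "1/6 * (2 * real n + 1) * (real n + 1) \<le> (real n)\<^sup>2"
      "1/6 * (2 * real n - 1) * (real n - 1) \<le> (real n)\<^sup>2"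
      unfolding power2_eq_square by linarith+
  qed
  then show "0 \<le> maj_a n" "maj_a n \<le> (real n)\<^sup>2" "0 \<le> maj_b n" "maj_b n \<le> (real n)\<^sup>2"
    "maj_a 0 = 0" "maj_a 1 = 0" "maj_b 0 = 0" "maj_b 1 = 0"
    by (auto simp: maj_a_def maj_b_def tail_def)
qed

definition moment :: "nat \<Rightarrow> (nat \<Rightarrow> real) \<Rightarrow> real \<Rightarrow> real" where
  "moment k C x = (\<Sum>n. real n ^ k * C n * x ^ n)"

lemma moment_sums:
  assumes "\<And>n. 0 \<le> C n" "\<And>n. C n \<le> (real n)\<^sup>2" "\<bar>x\<bar> < 1"
  shows "(\<lambda>n. C n * x ^ n) sums moment 0 C x" "(\<lambda>n. real n * C n * x ^ n) sums moment 1 C x"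
  using summable_quadratic_coeffs[of C x] assms by (auto simp: moment_def summable_sums)

lemmas maj_a_sums = moment_sums[OF maj_bounds(1,2)]
lemmas maj_b_sums = moment_sums[OF maj_bounds(3,4)]

definition radius_poly :: "real \<Rightarrow> real \<Rightarrow> real" where
  "radius_poly \<alpha> r = 2 * (1 - \<alpha>) * (1 - r) ^ 4 + \<alpha> * (1 - r)\<^sup>2 - (1 + r)\<^sup>2"

text \<open>For \<open>n \<ge> 2\<close> the coefficients combine to \<open>n (A\<^sub>n + B\<^sub>n) = (2n\<^sup>3 + n)/3\<close> and \<open>A\<^sub>n - B\<^sub>n = n\<close>, so the sums
  of \<open>n\<^sup>3 x\<^sup>n\<close> and \<open>n x\<^sup>n\<close> suffice. This identity is the origin of the equation for the radius.\<close>

lemma maj_moments_eq: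
  assumes "\<bar>x\<bar> < 1"
  shows "moment 1 maj_a x + moment 1 maj_b x - \<alpha> * (moment 0 maj_a x - moment 0 maj_b x)
    = (1 - \<alpha>) * x - x * radius_poly \<alpha> x / (1 - x) ^ 4"
proof -
  \<comment> \<open>The subtracted single term removes \<open>n = 1\<close>, where \<open>(2n\<^sup>3 + n)/3 = n = 1\<close> but the majorants vanish.\<close>
  have "(\<lambda>n. (real n ^ 3 * x ^ n) * (2/3) + (real n * x ^ n) / 3 - (if n = 1 then x else 0))
      sums (x * (1 + 4 * x + x\<^sup>2) / (1 - x) ^ 4 * (2/3) + x / (1 - x)\<^sup>2 / 3 - x)"
    by (intro sums_add sums_diff sums_mult2 sums_divide power_moment_sums assms sums_single)
  also have "(\<lambda>n. (real n ^ 3 * x ^ n) * (2/3) + (real n * x ^ n) / 3 - (if n = 1 then x else 0))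
      = (\<lambda>n. real n * maj_a n * x ^ n + real n * maj_b n * x ^ n)"
    by (auto simp: maj_a_def maj_b_def tail_def fun_eq_iff less_2_cases_iff power3_eq_cube field_simps)
  finally have 1: "moment 1 maj_a x + moment 1 maj_b x
      = x * (1 + 4 * x + x\<^sup>2) / (1 - x) ^ 4 * (2/3) + x / (1 - x)\<^sup>2 / 3 - x"
    using sums_add[OF maj_a_sums(2) maj_b_sums(2), OF assms assms] by (rule sums_unique2[symmetric])
  have "(\<lambda>n. real n * x ^ n - (if n = 1 then x else 0)) sums (x / (1 - x)\<^sup>2 - x)"
    by (intro sums_diff power_moment_sums assms sums_single)
  also have "(\<lambda>n. real n * x ^ n - (if n = 1 then x else 0)) = (\<lambda>n. maj_a n * x ^ n - maj_b n * x ^ n)"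
    by (auto simp: maj_a_def maj_b_def tail_def fun_eq_iff less_2_cases_iff field_simps)
  finally have 0: "moment 0 maj_a x - moment 0 maj_b x = x / (1 - x)\<^sup>2 - x"
    using sums_diff[OF maj_a_sums(1) maj_b_sums(1), OF assms assms] by (rule sums_unique2[symmetric])
  define y where "y = 1 - x"
  have y: "y \<noteq> 0" "x = 1 - y"
    using assms by (auto simp: y_def)
  show ?thesis
    unfolding 0 1 radius_poly_def
    using y(1) by (simp add: y(2) divide_simps) (simp add: eval_nat_numeral algebra_simps)
qed

lemma radius_poly_strict_antimono:
  assumes "0 \<le> \<alpha>" "\<alpha> < 1" "0 \<le> x" "x < y" "y \<le> 1"
  shows "radius_poly \<alpha> y < radius_poly \<alpha> x"
proof -
  have "2 * (1 - \<alpha>) * (1 - y) ^ 4 \<le> 2 * (1 - \<alpha>) * (1 - x) ^ 4"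
    using assms by (intro mult_left_mono power_mono) auto
  moreover have "\<alpha> * (1 - y)\<^sup>2 \<le> \<alpha> * (1 - x)\<^sup>2"
    using assms by (intro mult_left_mono power_mono) auto
  moreover have "(1 + x)\<^sup>2 < (1 + y)\<^sup>2"
    using assms by (intro power_strict_mono) auto
  ultimately show ?thesis
    by (simp add: radius_poly_def)
qed

lemma ex1_radius:
  assumes "0 \<le> \<alpha>" "\<alpha> < 1"
  shows "\<exists>!r. is_radius \<alpha> r"
proof -
  have "\<exists>r\<ge>0. r \<le> 1 \<and> radius_poly \<alpha> r = 0"
    using assms by (intro IVT2') (auto simp: radius_poly_def intro!: continuous_intros)
  then obtain r where r: "0 \<le> r" "r \<le> 1" "radius_poly \<alpha> r = 0"
    by blast
  then have "r \<noteq> 0" "r \<noteq> 1"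
    using assms by (auto simp: radius_poly_def)
  with r have "is_radius \<alpha> r"
    by (simp add: is_radius_def radius_poly_def)
  moreover have "x = y" if "is_radius \<alpha> x" "is_radius \<alpha> y" for x y
    using that radius_poly_strict_antimono[OF assms, of x y] radius_poly_strict_antimono[OF assms, of y x]
    by (cases x y rule: linorder_cases) (auto simp: is_radius_def radius_poly_def)
  ultimately show ?thesis
    by blast
qed

text \<open>Univalence needs the inequality of order \<open>0\<close>. The polynomial of order \<open>\<alpha>\<close> is \<open>\<alpha> Y - Z\<close> with
  \<open>Z = (1 + r)\<^sup>2 - 2 (1 - r)\<^sup>4\<close> and \<open>Y = (1 - r)\<^sup>2 - 2 (1 - r)\<^sup>4 \<le> Z\<close>; the one of order \<open>0\<close> is
  \<open>- Z\<close>. If \<open>Z \<ge> 0\<close> then \<open>\<alpha> Y \<le> \<alpha> Z \<le> Z\<close>.\<close>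

lemma radius_poly_order_0_pos:
  assumes "0 \<le> \<alpha>" "\<alpha> < 1" "0 \<le> r" "0 < radius_poly \<alpha> r"
  shows "0 < radius_poly 0 r"
proof (rule ccontr)
  assume "\<not> 0 < radius_poly 0 r"
  then have X: "0 \<le> (1 + r)\<^sup>2 - 2 * (1 - r) ^ 4"
    by (simp add: radius_poly_def)
  have "(1 - r)\<^sup>2 \<le> (1 + r)\<^sup>2"
    using assms by (simp add: power2_eq_square algebra_simps)
  then have "\<alpha> * ((1 - r)\<^sup>2 - 2 * (1 - r) ^ 4) \<le> \<alpha> * ((1 + r)\<^sup>2 - 2 * (1 - r) ^ 4)"
    using assms by (intro mult_left_mono) auto
  also have "\<dots> \<le> 1 * ((1 + r)\<^sup>2 - 2 * (1 - r) ^ 4)"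
    using assms X by (intro mult_right_mono) auto
  finally show False
    using assms by (simp add: radius_poly_def algebra_simps)
qed

section \<open>Estimates under the coefficient bounds\<close>

definition h_part :: "(nat \<Rightarrow> complex) \<Rightarrow> complex \<Rightarrow> complex" where
  "h_part a z = z + power_series (tail a) z"

definition g_part :: "(nat \<Rightarrow> complex) \<Rightarrow> complex \<Rightarrow> complex" where
  "g_part b = power_series (tail b)"

lemma coeff_bounds_tails:
  assumes "coeff_bounds a b"
  shows "norm (tail a n) \<le> maj_a n" "norm (tail b n) \<le> maj_b n"
    and "norm (tail a n) \<le> (real n)\<^sup>2" "norm (tail b n) \<le> (real n)\<^sup>2"
proof -
  show *: "norm (tail a n) \<le> maj_a n" "norm (tail b n) \<le> maj_b n"
    using assms by (auto simp: coeff_bounds_def tail_def maj_a_def maj_b_def)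
  show "norm (tail a n) \<le> (real n)\<^sup>2" "norm (tail b n) \<le> (real n)\<^sup>2"
    using order_trans[OF *(1) maj_bounds(2)] order_trans[OF *(2) maj_bounds(4)] .
qed

text \<open>The bound on \<open>b\<^sub>1\<close> is \<open>0\<close>, so the series for \<open>g\<close> starts at \<open>n = 2\<close> as well.\<close>

lemma harmonic_map_eq:
  assumes "coeff_bounds a b" "norm z < 1"
  shows "harmonic_map a b z = h_part a z + cnj (g_part b z)"
proof -
  note sums = power_series_sums(1)[OF coeff_bounds_tails(3)] power_series_sums(1)[OF coeff_bounds_tails(4)]
  have "b 1 = 0"
    using assms(1) by (auto simp: coeff_bounds_def dest: spec[of _ 1])
  have "(\<lambda>n. tail a (n + 2) * z ^ (n + 2)) sums power_series (tail a) z"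
    using sums(1)[OF assms] by (subst sums_iff_shift) (simp add: tail_0_1 eval_nat_numeral)
  then have h: "series_h a z = h_part a z"
    by (simp add: series_h_def h_part_def tail_def sums_iff)
  have "(\<lambda>n. tail b (n + 1) * z ^ (n + 1)) sums power_series (tail b) z"
    using sums(2)[OF assms] by (subst sums_iff_shift) (simp add: tail_0_1)
  moreover have "tail b (n + 1) = b (n + 1)" for n
    using \<open>b 1 = 0\<close> by (cases n) (auto simp: tail_def)
  ultimately have "series_g b z = g_part b z"
    by (simp add: series_g_def g_part_def sums_iff)
  with h show ?thesis
    by (simp add: harmonic_map_def)
qed

lemma parts_has_field_derivative:
  assumes "coeff_bounds a b" "norm z < 1"
  shows "(h_part a has_field_derivative 1 + deriv (power_series (tail a)) z) (at z)"
    and "(g_part b has_field_derivative deriv (power_series (tail b)) z) (at z)"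
  using power_series_sums(2)[OF coeff_bounds_tails(3)[OF assms(1)] assms(2)]
    power_series_sums(2)[OF coeff_bounds_tails(4)[OF assms(1)] assms(2)]
  unfolding h_part_def[abs_def] g_part_def by (auto intro!: derivative_eq_intros)

text \<open>With \<open>X = D - \<alpha> f\<close> the claim is \<open>\<bar>X - f\<bar> < \<bar>X + f\<bar>\<close>. The linear term contributes \<open>- \<alpha> z\<close> to
  \<open>X - f\<close> and \<open>(2 - \<alpha>) z\<close> to \<open>X + f\<close>, and the \<open>n\<close>-th terms carry the factors \<open>n - 1 - \<alpha>\<close>, \<open>n + 1 + \<alpha>\<close>
  and \<open>n + 1 - \<alpha>\<close>, \<open>n - 1 + \<alpha>\<close>. Adding up leaves twice the sum evaluated in \<open>maj_moments_eq\<close>. Bounding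
  \<open>\<bar>D - f\<bar>\<close> by \<open>(1 - \<alpha>) \<bar>f\<bar>\<close> instead would produce \<open>n + 2 - \<alpha>\<close> in place of \<open>n + \<alpha>\<close> and lose sharpness.\<close>

lemma starlike_order_inequality:
  assumes ab: "coeff_bounds a b" and \<alpha>: "0 \<le> \<alpha>" "\<alpha> < 1"
    and z: "norm z < 1" "z \<noteq> 0" and P: "0 < radius_poly \<alpha> (norm z)"
  defines "f \<equiv> h_part a z + cnj (g_part b z)"
  shows "0 < Re ((z * deriv (h_part a) z - cnj (z * deriv (g_part b) z) - of_real \<alpha> * f) * cnj f)"
proof -
  define r where "r = norm z"
  define H G where "H = power_series (tail a) z" and "G = power_series (tail b) z"
  define H' G' where "H' = z * deriv (power_series (tail a)) z" and "G' = z * deriv (power_series (tail b)) z"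
  define X where "X = z * deriv (h_part a) z - cnj (z * deriv (g_part b) z) - of_real \<alpha> * f"
  have X: "X = z + H' - cnj G' - of_real \<alpha> * f"
    using parts_has_field_derivative[OF ab z(1), THEN DERIV_imp_deriv]
    by (simp add: X_def H'_def G'_def algebra_simps)
  have f: "f = z + H + cnj G"
    by (simp add: f_def h_part_def g_part_def H_def G_def)
  note est = norm_power_series_combination_le[OF _ _ _ _ _ z(1), folded r_def]
  have estH: "norm (H' + of_real s * H) \<le> moment 1 maj_a r + s * moment 0 maj_a r" if "-2 \<le> s" for s
    using est[OF coeff_bounds_tails(1)[OF ab] maj_bounds(2,5,6) that]
    by (simp add: H_def H'_def moment_def)
  have estG: "norm (G' + of_real s * G) \<le> moment 1 maj_b r + s * moment 0 maj_b r" if "-2 \<le> s" for s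
    using est[OF coeff_bounds_tails(2)[OF ab] maj_bounds(4,7,8) that]
    by (simp add: G_def G'_def moment_def)
  have "norm (X - f) \<le> \<alpha> * r + (moment 1 maj_a r - (1 + \<alpha>) * moment 0 maj_a r)
      + (moment 1 maj_b r + (1 + \<alpha>) * moment 0 maj_b r)"
  proof -
    have "X - f = - (of_real \<alpha> * z) + (H' + of_real (- (1 + \<alpha>)) * H) - cnj (G' + of_real (1 + \<alpha>) * G)"
      by (simp add: X f algebra_simps)
    also have "norm \<dots> \<le> norm (of_real \<alpha> * z) + norm (H' + of_real (- (1 + \<alpha>)) * H)
        + norm (G' + of_real (1 + \<alpha>) * G)"
      by (metis (no_types, lifting) add_mono complex_mod_cnj norm_minus_cancel norm_triangle_ineq
          norm_triangle_ineq4 order_refl order_trans)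
    also have "norm (of_real \<alpha> * z) = \<alpha> * r"
      using \<alpha> by (simp add: norm_mult r_def)
    finally show ?thesis
      using estH[of "- (1 + \<alpha>)"] estG[of "1 + \<alpha>"] \<alpha> by (simp add: algebra_simps)
  qed
  moreover have "(2 - \<alpha>) * r - (moment 1 maj_a r + (1 - \<alpha>) * moment 0 maj_a r)
      - (moment 1 maj_b r - (1 - \<alpha>) * moment 0 maj_b r) \<le> norm (X + f)"
  proof -
    have "of_real (2 - \<alpha>) * z = (X + f) - (H' + of_real (1 - \<alpha>) * H) + cnj (G' + of_real (- (1 - \<alpha>)) * G)"
      by (simp add: X f algebra_simps)
    also have "norm \<dots> \<le> norm (X + f) + norm (H' + of_real (1 - \<alpha>) * H)
        + norm (G' + of_real (- (1 - \<alpha>)) * G)"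
      by (metis (no_types, lifting) add_mono complex_mod_cnj norm_triangle_ineq
          norm_triangle_ineq4 order_refl order_trans)
    finally have "(2 - \<alpha>) * r \<le> \<dots>"
      using \<alpha> by (simp add: norm_mult r_def del: of_real_diff)
    then show ?thesis
      using estH[of "1 - \<alpha>"] estG[of "- (1 - \<alpha>)"] \<alpha> by (simp add: algebra_simps)
  qed
  moreover have "moment 1 maj_a r + moment 1 maj_b r - \<alpha> * (moment 0 maj_a r - moment 0 maj_b r) < (1 - \<alpha>) * r"
    using maj_moments_eq[of r \<alpha>] z P by (simp add: r_def)
  ultimately have "norm (X - f) < norm (X + f)"
    by (simp add: algebra_simps)
  then have "(norm (X - f))\<^sup>2 < (norm (X + f))\<^sup>2"
    by (intro power_strict_mono) auto
  moreover have "(norm (X + f))\<^sup>2 - (norm (X - f))\<^sup>2 = 4 * Re (X * cnj f)"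
    unfolding cmod_power2 by (simp add: power2_eq_square algebra_simps)
  ultimately show ?thesis
    unfolding X_def by simp
qed

text \<open>The radius polynomial of order \<open>0\<close> controls \<open>\<bar>h' - 1\<bar> + \<bar>g'\<bar> < 1\<close>. The estimate of
  \<open>z h'\<close> and \<open>z g'\<close> says nothing at the origin, where both perturbations have derivative \<open>0\<close>.\<close>

lemma deriv_dominated:
  assumes ab: "coeff_bounds a b" and z: "norm z < 1" and P: "0 < radius_poly 0 (norm z)"
  shows "norm (deriv (g_part b) z) < Re (deriv (h_part a) z)"
proof -
  define H' G' where "H' = deriv (power_series (tail a)) z" and "G' = deriv (power_series (tail b)) z"
  have eq: "deriv (h_part a) z = 1 + H'" "deriv (g_part b) z = G'"
    using parts_has_field_derivative[OF ab z, THEN DERIV_imp_deriv] by (simp_all add: H'_def G'_def)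
  have "norm H' + norm G' < 1"
  proof (cases "z = 0")
    case True
    then show ?thesis
      using deriv_power_series_0[of "tail a", OF coeff_bounds_tails(3)[OF ab]]
        deriv_power_series_0[of "tail b", OF coeff_bounds_tails(4)[OF ab]] by (simp add: H'_def G'_def tail_0_1)
  next
    case False
    note est = norm_power_series_combination_le[OF _ _ _ _ _ z, of _ _ 0]
    have "norm (z * H') \<le> moment 1 maj_a (norm z)"
      using est[OF coeff_bounds_tails(1)[OF ab] maj_bounds(2,5,6)] by (simp add: H'_def moment_def)
    moreover have "norm (z * G') \<le> moment 1 maj_b (norm z)"
      using est[OF coeff_bounds_tails(2)[OF ab] maj_bounds(4,7,8)] by (simp add: G'_def moment_def)
    moreover have "moment 1 maj_a (norm z) + moment 1 maj_b (norm z) < norm z"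
      using maj_moments_eq[of "norm z" 0] z P False by simp
    ultimately have "norm z * (norm H' + norm G') < norm z * 1"
      by (simp add: norm_mult algebra_simps)
    then show ?thesis
      using False by simp
  qed
  moreover have "1 - norm H' \<le> Re (1 + H')"
    using abs_Re_le_cmod[of H'] by simp
  ultimately show ?thesis
    unfolding eq by linarith
qed

section \<open>Sharpness and the main result\<close>

text \<open>The signs are chosen so that at the positive point \<open>r\<close> all terms of \<open>D - \<alpha> f\<close> with \<open>n \<ge> 2\<close> are
  negative and of maximal size. At the root of the radius polynomial they cancel the linear term, so
  the argument grows at exactly the rate \<open>\<alpha>\<close> there.\<close>

lemma sharp_at_radius:
  assumes r: "is_radius \<alpha> r"
  defines "a \<equiv> \<lambda>n. if n = 1 then 1 else - complex_of_real (1/6 * (2 * real n + 1) * (real n + 1))"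
    and "b \<equiv> \<lambda>n. complex_of_real (1/6 * (2 * real n - 1) * (real n - 1))"
  shows "coeff_bounds a b" and "\<not> arg_deriv_gt \<alpha> (harmonic_map a b) r"
proof -
  have "norm (b n) \<le> 1/6 * (2 * real n - 1) * (real n - 1)" if "n \<ge> 1" for n
  proof -
    have "0 \<le> 1/6 * (2 * real n - 1) * (real n - 1)"
      using that by simp
    then show ?thesis
      by (simp only: b_def norm_of_real abs_of_nonneg order_refl)
  qed
  moreover have "norm (a n) \<le> 1/6 * (2 * real n + 1) * (real n + 1)" for n
  proof (cases "n = 1")
    case False
    have "0 \<le> 1/6 * (2 * real n + 1) * (real n + 1)"
      by simp
    with False show ?thesis
      by (simp only: a_def if_False norm_minus_cancel norm_of_real abs_of_nonneg order_refl)
  qed (simp add: a_def)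
  ultimately show ab: "coeff_bounds a b"
    by (simp add: coeff_bounds_def a_def)
  have r01: "0 < r" "r < 1" and P: "radius_poly \<alpha> r = 0"
    using r by (auto simp: is_radius_def radius_poly_def)
  let ?z = "complex_of_real r"
  have z: "norm ?z < 1"
    using r01 by simp
  have ta: "tail a n = - of_real (maj_a n)" and tb: "tail b n = of_real (maj_b n)" for n
    by (auto simp: tail_def a_def b_def maj_a_def maj_b_def)
  note sa = power_series_sums(1,4)[of "tail a", OF coeff_bounds_tails(3)[OF ab] z]
  note sb = power_series_sums(1,4)[of "tail b", OF coeff_bounds_tails(4)[OF ab] z]
  have abs_r: "\<bar>r\<bar> < 1"
    using r01 by simp
  note ma = maj_a_sums[OF abs_r, THEN sums_of_real, where 'a = complex]
  note mb = maj_b_sums[OF abs_r, THEN sums_of_real, where 'a = complex]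
  have H: "power_series (tail a) ?z = - of_real (moment 0 maj_a r)"
    by (rule sums_unique2[OF sa(1)]) (use sums_minus[OF ma(1)] in \<open>simp add: ta mult.assoc\<close>)
  have H': "?z * deriv (power_series (tail a)) ?z = - of_real (moment 1 maj_a r)"
    by (rule sums_unique2[OF sa(2)]) (use sums_minus[OF ma(2)] in \<open>simp add: ta mult.assoc\<close>)
  have G: "power_series (tail b) ?z = of_real (moment 0 maj_b r)"
    by (rule sums_unique2[OF sb(1)]) (use mb(1) in \<open>simp add: tb mult.assoc\<close>)
  have G': "?z * deriv (power_series (tail b)) ?z = of_real (moment 1 maj_b r)"
    by (rule sums_unique2[OF sb(2)]) (use mb(2) in \<open>simp add: tb mult.assoc\<close>)
  define F where "F = (\<lambda>\<theta>. harmonic_map a b (of_real r * cis \<theta>))"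
  have F_eq: "F = (\<lambda>\<theta>. h_part a (of_real r * cis \<theta>) + cnj (g_part b (of_real r * cis \<theta>)))"
    unfolding F_def using r01 by (intro ext harmonic_map_eq[OF ab]) (simp add: norm_mult)
  have F0: "F 0 = of_real (r - moment 0 maj_a r + moment 0 maj_b r)"
    by (simp add: F_eq h_part_def g_part_def H G)
  have "(F has_vector_derivative \<i> * (?z * (1 + deriv (power_series (tail a)) ?z)
      - cnj (?z * deriv (power_series (tail b)) ?z))) (at 0 within {0..2*pi})"
    unfolding F_eq by (rule has_vector_derivative_along_circle[OF parts_has_field_derivative[OF ab z]]) simp
  also have "?z * (1 + deriv (power_series (tail a)) ?z) - cnj (?z * deriv (power_series (tail b)) ?z)
      = of_real (r - moment 1 maj_a r - moment 1 maj_b r)"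
    unfolding distrib_left H' G' by simp
  also have "r - moment 1 maj_a r - moment 1 maj_b r = \<alpha> * (r - moment 0 maj_a r + moment 0 maj_b r)"
    using maj_moments_eq[OF abs_r, of \<alpha>] P by (simp add: algebra_simps)
  also have "complex_of_real \<dots> = of_real \<alpha> * F 0"
    by (simp add: F0)
  finally have "(F has_vector_derivative \<i> * (of_real \<alpha> * F 0)) (at 0 within {0..2*pi})" .
  then have dF: "((\<lambda>\<theta>. harmonic_map a b (of_real r * cis \<theta>)) has_vector_derivative
      \<i> * (of_real \<alpha> * F 0)) (at 0 within {0..2*pi})"
    by (simp only: F_def)
  show "\<not> arg_deriv_gt \<alpha> (harmonic_map a b) r"
  proof
    assume "arg_deriv_gt \<alpha> (harmonic_map a b) r"
    then have "F 0 \<noteq> 0 \<and> \<alpha> < Im (\<i> * (of_real \<alpha> * F 0) / F 0)"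
      unfolding F_def by (rule log_deriv_gt_if_arg_deriv_gt[OF _ _ dF[unfolded F_def]]) simp
    then show False
      by auto
  qed
qed

theorem theorem3p1:
  fixes \<alpha> :: real
  assumes "0 \<le> \<alpha>" and "\<alpha> < 1"
  shows "(\<exists>!r. is_radius \<alpha> r) \<and>
    (\<forall>a b. coeff_bounds a b \<longrightarrow>
       inj_on (harmonic_map a b) (ball 0 (r_S \<alpha>)) \<and>
       fully_starlike_of_order \<alpha> (harmonic_map a b) (r_S \<alpha>)) \<and>
    (\<forall>R > r_S \<alpha>. \<exists>a b. coeff_bounds a b \<and>
       \<not> (inj_on (harmonic_map a b) (ball 0 R) \<and>
          fully_starlike_of_order \<alpha> (harmonic_map a b) R))"
proof (intro conjI allI impI)
  show ex1: "\<exists>!r. is_radius \<alpha> r"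
    by (rule ex1_radius[OF assms])
  then have rS: "is_radius \<alpha> (r_S \<alpha>)"
    unfolding r_S_def by (rule theI')
  then have rS01: "0 < r_S \<alpha>" "r_S \<alpha> < 1" and P0: "radius_poly \<alpha> (r_S \<alpha>) = 0"
    by (auto simp: is_radius_def radius_poly_def)
  {
    fix a b assume ab: "coeff_bounds a b"
    let ?f = "\<lambda>z. h_part a z + cnj (g_part b z)"
    have small: "norm z < 1" "0 < radius_poly \<alpha> (norm z)" "0 < radius_poly 0 (norm z)"
      if "z \<in> ball 0 (r_S \<alpha>)" for z :: complex
    proof -
      show "norm z < 1"
        using that rS01 by simp
      show P: "0 < radius_poly \<alpha> (norm z)"
        using radius_poly_strict_antimono[OF assms, of "norm z" "r_S \<alpha>"] that rS01 P0 by simp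
      show "0 < radius_poly 0 (norm z)"
        by (rule radius_poly_order_0_pos[OF assms norm_ge_zero P])
    qed
    have hol: "h_part a holomorphic_on ball 0 (r_S \<alpha>)" "g_part b holomorphic_on ball 0 (r_S \<alpha>)"
      using parts_has_field_derivative[OF ab small(1)] unfolding holomorphic_on_open[OF open_ball] by blast+
    have "?f 0 = 0"
      by (simp add: h_part_def g_part_def power_series_def tail_def)
    note main = fully_starlike_of_order_add_cnj[OF hol this assms(1) deriv_dominated[OF ab small(1,3)]
        starlike_order_inequality[OF ab assms small(1) _ small(2)]]
    have eq: "?f z = harmonic_map a b z" if "z \<in> ball 0 (r_S \<alpha>)" for z
      using harmonic_map_eq[OF ab small(1)[OF that]] by simp
    show "inj_on (harmonic_map a b) (ball 0 (r_S \<alpha>))"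
      using main(1) inj_on_cong[of "ball 0 (r_S \<alpha>)" ?f "harmonic_map a b"] eq by blast
    show "fully_starlike_of_order \<alpha> (harmonic_map a b) (r_S \<alpha>)"
      by (rule fully_starlike_of_order_cong[OF eq rS01(1) main(2)])
  }
  \<comment> \<open>The circle of radius \<open>r_S \<alpha>\<close> itself lies in the larger disk and already violates the strict bound.\<close>
  fix R assume "r_S \<alpha> < R"
  then show "\<exists>a b. coeff_bounds a b \<and>
      \<not> (inj_on (harmonic_map a b) (ball 0 R) \<and> fully_starlike_of_order \<alpha> (harmonic_map a b) R)"
    using sharp_at_radius[OF rS] rS01 unfolding fully_starlike_of_order_def by blast
qed

end
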